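(* Let $T$ be a compact metric space, $d\in\mathbb N$, $r\in(0,\infty)$, and let $X=(X_t)_{t\in T}=(X_{1,t},\dots,X_{d,t})_{t\in T}$ be an $\mathbb R^d$-valued pathwise continuous process with $\mathbb E\|X\|_{\sup}^r<\infty$; write $X_i=(X_{i,t})_{t\in T}$. Let $c\in(0,\infty)$ be such that $|\cdot|_\infty\le c\,|\cdot|_r$ on $\mathbb R^d$. Then for every $n,n_1,\dots,n_d\in\mathbb N$ such that $\prod_{i=1}^dn_i\le n$, $$\max_{1\le i\le d}e_{n,r}(X_i,C(T))^r\le e_{n,r}(X,C_{\mathbb R^d}(T))^r\le c^r\sum_{i=1}^de_{n_i,r}(X_i,C(T))^r .$$
   Context: On $\mathbb R^d$, $|x|_\infty=\max_i|x_i|$ and $|x|_r=(\sum_{i=1}^d|x_i|^r)^{1/r}$. $C_{\mathbb R^d}(T)$ is the space of continuous functions $T\to\mathbb R^d$ with the norm $\|f\|_{\sup}=\sup_{t\in T}|f(t)|_\infty$, and $C(T)=C_{\mathbb R}(T)$. $X$ and $X_i$ are viewed as random vectors in $C_{\mathbb R^d}(T)$ and $C(T)$. For a random variable $Y$ in a Banach space $(G,\|\cdot\|)$ and $m\in\mathbb N$, $$e_{m,r}(Y,G):=\inf\Big\{\big(\mathbb E\min_{a\in\alpha}\|Y-a\|^r\big)^{1/r}:\alpha\subset G,\ 1\le\mathrm{card}(\alpha)\le m\Big\}.$$ *)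

theory Defs
  imports "HOL-Probability.Probability"
begin

text \<open>The library norm on \<^typ>\<open>real ^ 'd\<close> is Euclidean, so the norm of
  $C_{R^d}(T)$ is defined separately; \<^const>\<open>infnorm\<close> is the maximum norm
  (see \<open>infnorm_cart\<close>). For real-valued functions the library norm
  on \<open>\<Rightarrow>\<^sub>C\<close> is already the supremum norm.\<close>

definition sup_norm :: "('t::topological_space \<Rightarrow>\<^sub>C (real ^ 'd)) \<Rightarrow> real" where
  "sup_norm f = (SUP t. infnorm (apply_bcontfun f t))"

definition lr_norm :: "real \<Rightarrow> real ^ 'd \<Rightarrow> real" where
  "lr_norm r x = (\<Sum>i\<in>UNIV. \<bar>x $ i\<bar> powr r) powr (1 / r)"

text \<open>The norm \<open>N\<close> of the Banach space is an explicit argument because it need not be the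
  one of the type class. The condition \<^prop>\<open>1 \<le> card \<alpha>\<close> makes \<open>\<alpha>\<close> finite and nonempty.
  The expectation is a Bochner integral, hence meaningful only if \<open>N (Y \<omega>) powr r\<close> has
  finite expectation; for infinite moments the value is junk.\<close>

definition quant_error ::
  "'w measure \<Rightarrow> ('g::real_vector \<Rightarrow> real) \<Rightarrow> real \<Rightarrow> nat \<Rightarrow> ('w \<Rightarrow> 'g) \<Rightarrow> real" where
  "quant_error M N r m Y =
     (INF \<alpha>\<in>{\<alpha>. 1 \<le> card \<alpha> \<and> card \<alpha> \<le> m}.
        (\<integral>\<omega>. (MIN a\<in>\<alpha>. N (Y \<omega> - a) powr r) \<partial>M) powr (1 / r))"

text \<open>On a compact space every continuous path is bounded, so \<open>\<Rightarrow>\<^sub>C\<close> consists of all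
  continuous functions and the following is the path itself.\<close>

definition path_of ::
  "('t::topological_space \<Rightarrow> 'w \<Rightarrow> 'b::metric_space) \<Rightarrow> 'w \<Rightarrow> ('t \<Rightarrow>\<^sub>C 'b)" where
  "path_of X \<omega> = Bcontfun (\<lambda>t. X t \<omega>)"

lemma apply_path_of:
  fixes X :: "'t::topological_space \<Rightarrow> 'w \<Rightarrow> 'b::metric_space"
  assumes "compact (UNIV :: 't set)" and "continuous_on UNIV (\<lambda>t. X t \<omega>)"
  shows "apply_bcontfun (path_of X \<omega>) t = X t \<omega>"
proof -
  have "(\<lambda>t. X t \<omega>) \<in> bcontfun"
    using assms compact_continuous_image[OF assms(2,1)]
    by (simp add: bcontfun_def compact_imp_bounded)
  then show ?thesis
    by (simp add: path_of_def Bcontfun_inverse)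
qed

end

theory Submission
  imports Defs
begin

text \<open>Both inequalities compare codebooks pointwise, before any expectation is taken.

For the lower bound, replace a codebook of vector-valued functions by the set of the
\<open>i\<close>-th components of its members. This does not increase the number of code points, and it does
not increase the distance to the nearest one, since the supremum norm of a component is
at most \<^const>\<open>sup_norm\<close> of the vector function (\<open>component_codebook\<close>, \<open>MIN_component_le\<close>).

For the upper bound, combine codebooks of the components into their product, which has at most
\<open>\<Prod>i\<in>UNIV. k i\<close> members. The components of a code point can then be chosen independently, each nearest
to the component of the path that it approximates; as \<open>infnorm\<close> is at most \<open>c\<close> times the
\<open>r\<close>-norm, the error to the power \<open>r\<close> is at most \<open>c powr r\<close> times the sum of the errors of the components to
the power \<open>r\<close> (\<open>product_codebook\<close>, \<open>MIN_product_le\<close>). Near-optimal codebooks for the components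
then give the claim up to an arbitrarily small error, which suffices whether or not optimal ones exist.

Taking expectations uses monotonicity and additivity of the Bochner integral, so all distances have to
be measurable with finite \<open>r\<close>-th moment. Measurability of a supremum over \<open>T\<close> comes from a countable
dense subset of \<open>T\<close> and path continuity (\<open>borel_measurable_SUP_continuous\<close>); the moments come from the
triangle inequality and the moment assumption on \<open>X\<close> (\<open>integrable_powr_le_add_const\<close>).\<close>

section \<open>Measurability of suprema of continuous processes\<close>

text \<open>Take the centres of finite covers by balls of radius \<open>1 / (n + 1)\<close>, for all \<open>n\<close>.\<close>

lemma compact_metric_countable_dense:
  assumes "compact (UNIV :: 't::metric_space set)"
  obtains D :: "'t::metric_space set" where "countable D" "closure D = UNIV"
proof -
  have "\<exists>K :: 't set. finite K \<and> UNIV \<subseteq> (\<Union>x\<in>K. ball x e)" if "e > 0" for e :: real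
    using assms that by (simp add: compact_eq_totally_bounded)
  then have "\<forall>n. \<exists>K :: 't set. finite K \<and> UNIV \<subseteq> (\<Union>x\<in>K. ball x (1 / real (Suc n)))"
    using zero_less_Suc of_nat_0_less_iff zero_less_divide_1_iff by blast
  then obtain K :: "nat \<Rightarrow> 't set"
    where K: "\<And>n. finite (K n)" "\<And>n. UNIV \<subseteq> (\<Union>x\<in>K n. ball x (1 / real (Suc n)))"
    by metis
  have "t \<in> closure (\<Union>n. K n)" for t
    unfolding closure_approachable
  proof (intro allI impI)
    fix e :: real assume "0 < e"
    then obtain n where n: "1 / real (Suc n) < e"
      using nat_approx_posE by blast
    obtain x where "x \<in> K n" "dist x t < 1 / real (Suc n)"
      using K(2)[of n] by (auto simp: subset_eq)
    with n show "\<exists>y\<in>(\<Union>n. K n). dist y t < e"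
      by (meson UN_I UNIV_I less_trans)
  qed
  moreover have "countable (\<Union>n. K n)"
    using K(1) by (simp add: countable_finite)
  ultimately show thesis
    using that by blast
qed

lemma cSUP_eq_cSUP_dense:
  fixes g :: "'t::topological_space \<Rightarrow> real"
  assumes "continuous_on UNIV g" "bdd_above (range g)" "closure D = UNIV"
  shows "(SUP t. g t) = (SUP t\<in>D. g t)"
proof (rule antisym)
  have bdd: "bdd_above (g ` D)"
    using assms(2) by (rule bdd_above_mono) auto
  have "g t \<le> (SUP t\<in>D. g t)" for t
  proof (rule continuous_le_on_closure[of D g])
    show "continuous_on (closure D) g" "t \<in> closure D"
      using assms by auto
    show "g s \<le> (SUP t\<in>D. g t)" if "s \<in> D" for s
      using that bdd by (rule cSUP_upper)
  qed
  then show "(SUP t. g t) \<le> (SUP t\<in>D. g t)"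
    by (intro cSUP_least) auto
  have "D \<noteq> {}"
    using assms(3) by auto
  then show "(SUP t\<in>D. g t) \<le> (SUP t. g t)"
    using assms(2) by (intro cSUP_subset_mono) auto
qed

text \<open>By continuity, the supremum over a countable dense set of times is the supremum over all times.\<close>

lemma borel_measurable_SUP_continuous:
  fixes Z :: "'t::metric_space \<Rightarrow> 'w \<Rightarrow> real"
  assumes "compact (UNIV :: 't set)"
    and meas: "\<And>t. Z t \<in> borel_measurable M"
    and cont: "\<And>\<omega>. \<omega> \<in> space M \<Longrightarrow> continuous_on UNIV (\<lambda>t. Z t \<omega>)"
  shows "(\<lambda>\<omega>. SUP t. Z t \<omega>) \<in> borel_measurable M"
proof -
  obtain D :: "'t set" where D: "countable D" "closure D = UNIV"
    using compact_metric_countable_dense[OF assms(1)] .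
  have bdd: "bdd_above (range (\<lambda>t. Z t \<omega>))" if "\<omega> \<in> space M" for \<omega>
    using compact_continuous_image[OF cont[OF that] assms(1)]
    by (simp add: bounded_imp_bdd_above compact_imp_bounded)
  have "(\<lambda>\<omega>. SUP t\<in>D. Z t \<omega>) \<in> borel_measurable M"
  proof (rule borel_measurable_cSUP)
    show "bdd_above ((\<lambda>t. Z t \<omega>) ` D)" if "\<omega> \<in> space M" for \<omega>
      using bdd[OF that] by (rule bdd_above_mono) auto
  qed (use D meas in auto)
  then show ?thesis
    by (rule measurable_cong[THEN iffD2, rotated])
      (use D cont bdd in \<open>auto intro!: cSUP_eq_cSUP_dense\<close>)
qed

section \<open>Quantization errors as infima of distortions\<close>

definition distortion ::
  "'w measure \<Rightarrow> ('g::real_vector \<Rightarrow> real) \<Rightarrow> real \<Rightarrow> 'g set \<Rightarrow> ('w \<Rightarrow> 'g) \<Rightarrow> real" where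
  "distortion M N r \<alpha> Y = (\<integral>\<omega>. (MIN a\<in>\<alpha>. N (Y \<omega> - a) powr r) \<partial>M)"

definition codebooks :: "nat \<Rightarrow> 'g set set" where
  "codebooks m = {\<alpha>. 1 \<le> card \<alpha> \<and> card \<alpha> \<le> m}"

lemma codebooksD:
  assumes "\<alpha> \<in> codebooks m"
  shows "finite \<alpha>" "\<alpha> \<noteq> {}" "card \<alpha> \<le> m"
  using assms by (auto simp: codebooks_def Suc_le_eq card_gt_0_iff)

lemma codebooksI: "finite \<alpha> \<Longrightarrow> \<alpha> \<noteq> {} \<Longrightarrow> card \<alpha> \<le> m \<Longrightarrow> \<alpha> \<in> codebooks m"
  by (auto simp: codebooks_def Suc_le_eq card_gt_0_iff)

lemma quant_error_eq: "quant_error M N r m Y = (INF \<alpha>\<in>codebooks m. distortion M N r \<alpha> Y powr (1 / r))"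
  by (simp add: quant_error_def codebooks_def distortion_def)

lemma distortion_nonneg:
  assumes "\<alpha> \<in> codebooks m"
  shows "0 \<le> distortion M N r \<alpha> Y"
  unfolding distortion_def
  by (rule Bochner_Integration.integral_nonneg) (use codebooksD[OF assms] in auto)

lemma quant_error_powr_le_distortion:
  assumes "0 < r" "\<alpha> \<in> codebooks m"
  shows "quant_error M N r m Y powr r \<le> distortion M N r \<alpha> Y"
proof -
  have "0 \<le> quant_error M N r m Y"
    unfolding quant_error_eq using assms(2) by (intro cINF_greatest) auto
  moreover have "quant_error M N r m Y \<le> distortion M N r \<alpha> Y powr (1 / r)"
    unfolding quant_error_eq using assms(2) by (intro cINF_lower bdd_belowI2[of _ 0]) auto
  ultimately have "quant_error M N r m Y powr r \<le> (distortion M N r \<alpha> Y powr (1 / r)) powr r"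
    using assms(1) by (intro powr_mono2) auto
  also have "\<dots> = distortion M N r \<alpha> Y"
    using assms(1) distortion_nonneg[OF assms(2), of M N r Y] by (simp add: powr_powr)
  finally show ?thesis .
qed

text \<open>The condition \<open>1 \<le> m\<close> provides a codebook: the infimum over the empty set is unspecified.\<close>

lemma le_quant_error_powr:
  fixes N :: "'g::real_vector \<Rightarrow> real"
  assumes "0 < r" "1 \<le> m" "0 \<le> b"
    and "\<And>\<alpha>. \<alpha> \<in> codebooks m \<Longrightarrow> b \<le> distortion M N r \<alpha> Y"
  shows "b \<le> quant_error M N r m Y powr r"
proof -
  have "{0 :: 'g} \<in> codebooks m"
    using assms(2) by (intro codebooksI) auto
  then have "b powr (1 / r) \<le> quant_error M N r m Y"
    unfolding quant_error_eq using assms by (intro cINF_greatest powr_mono2) auto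
  then have "(b powr (1 / r)) powr r \<le> quant_error M N r m Y powr r"
    using assms(1) by (intro powr_mono2) auto
  then show ?thesis
    using assms(1,3) by (simp add: powr_powr)
qed

lemma near_optimal_codebook:
  assumes "0 < r" "1 \<le> m" "0 < \<epsilon>"
  obtains \<alpha> where "\<alpha> \<in> codebooks m" "distortion M N r \<alpha> Y < quant_error M N r m Y powr r + \<epsilon>"
  using le_quant_error_powr[of r m "quant_error M N r m Y powr r + \<epsilon>" M N Y] assms that
  by (smt (verit) powr_ge_zero)

lemma integrable_MIN:
  fixes f :: "'a \<Rightarrow> 'w \<Rightarrow> real"
  assumes "finite A" "A \<noteq> {}" "\<And>a. a \<in> A \<Longrightarrow> integrable M (f a)"
  shows "integrable M (\<lambda>\<omega>. MIN a\<in>A. f a \<omega>)"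
  using assms
proof (induction A rule: finite_ne_induct)
  case (insert x A)
  then have "integrable M (\<lambda>\<omega>. min (f x \<omega>) (MIN a\<in>A. f a \<omega>))"
    by (intro integrable_min) auto
  then show ?case
    using insert by simp
qed simp

text \<open>For \<open>r < 1\<close> there is no Minkowski inequality; the bound
\<open>(x + y) powr r \<le> (2 * max x y) powr r \<le> 2 powr r * (x powr r + y powr r)\<close> works for every \<open>r > 0\<close>.\<close>

lemma integrable_powr_le_add_const:
  fixes f g :: "'w \<Rightarrow> real"
  assumes "finite_measure M" "0 < r" "f \<in> borel_measurable M"
    and int: "integrable M (\<lambda>\<omega>. g \<omega> powr r)"
    and bound: "\<And>\<omega>. \<omega> \<in> space M \<Longrightarrow> 0 \<le> f \<omega>" "\<And>\<omega>. \<omega> \<in> space M \<Longrightarrow> f \<omega> \<le> g \<omega> + K"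
    and "\<And>\<omega>. \<omega> \<in> space M \<Longrightarrow> 0 \<le> g \<omega>" "0 \<le> K"
  shows "integrable M (\<lambda>\<omega>. f \<omega> powr r)"
proof (rule Bochner_Integration.integrable_bound)
  interpret finite_measure M by fact
  show "integrable M (\<lambda>\<omega>. 2 powr r * (g \<omega> powr r + K powr r))"
    using int by simp
  show "(\<lambda>\<omega>. f \<omega> powr r) \<in> borel_measurable M"
    using assms(3) by measurable
  show "AE \<omega> in M. norm (f \<omega> powr r) \<le> norm (2 powr r * (g \<omega> powr r + K powr r))"
  proof (rule AE_I2)
    fix \<omega> assume \<omega>: "\<omega> \<in> space M"
    have "f \<omega> powr r \<le> (2 * max (g \<omega>) K) powr r"
      using assms(2) bound[OF \<omega>] by (intro powr_mono2) auto
    also have "\<dots> = 2 powr r * max (g \<omega>) K powr r"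
      using assms(7)[OF \<omega>] assms(8) by (simp add: powr_mult)
    also have "\<dots> \<le> 2 powr r * (g \<omega> powr r + K powr r)"
      by (intro mult_left_mono) (auto simp: max_def)
    finally show "norm (f \<omega> powr r) \<le> norm (2 powr r * (g \<omega> powr r + K powr r))"
      by simp
  qed
qed

section \<open>Components and the maximum norm\<close>

definition component :: "'d::finite \<Rightarrow> ('t::topological_space \<Rightarrow>\<^sub>C (real ^ 'd)) \<Rightarrow> ('t \<Rightarrow>\<^sub>C real)" where
  "component i f = Bcontfun (\<lambda>t. apply_bcontfun f t $ i)"

definition of_components :: "('d::finite \<Rightarrow> ('t::topological_space \<Rightarrow>\<^sub>C real)) \<Rightarrow> ('t \<Rightarrow>\<^sub>C (real ^ 'd))" where
  "of_components F = Bcontfun (\<lambda>t. \<chi> i. apply_bcontfun (F i) t)"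

lemma apply_component:
  fixes f :: "'t::topological_space \<Rightarrow>\<^sub>C (real ^ 'd)"
  shows "apply_bcontfun (component i f) t = apply_bcontfun f t $ i"
proof -
  have "bounded (range (\<lambda>t. apply_bcontfun f t $ i))"
    using bounded_component_cart[OF bounded_apply_bcontfun[of f], of i] by (simp add: image_image)
  then have "(\<lambda>t. apply_bcontfun f t $ i) \<in> bcontfun"
    by (auto simp: bcontfun_def intro!: continuous_intros)
  then show ?thesis
    by (simp add: component_def Bcontfun_inverse)
qed

lemma apply_of_components:
  fixes F :: "'d::finite \<Rightarrow> ('t::topological_space \<Rightarrow>\<^sub>C real)"
  shows "apply_bcontfun (of_components F) t $ i = apply_bcontfun (F i) t"
proof -
  have "norm (\<chi> i. apply_bcontfun (F i) t) \<le> (\<Sum>i\<in>UNIV. norm (F i))" for t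
    by (rule order_trans[OF norm_le_l1_cart]) (auto intro!: sum_mono norm_bounded[of "F _" t, simplified])
  then have "(\<lambda>t. \<chi> i. apply_bcontfun (F i) t) \<in> bcontfun"
    by (intro bcontfun_normI continuous_intros) auto
  then show ?thesis
    by (simp add: of_components_def Bcontfun_inverse)
qed

lemma infnorm_le_sup_norm:
  fixes f :: "'t::topological_space \<Rightarrow>\<^sub>C (real ^ 'd)"
  shows "infnorm (apply_bcontfun f t) \<le> sup_norm f"
  unfolding sup_norm_def
  by (intro cSUP_upper bdd_aboveI2[of _ _ "norm f"] order_trans[OF infnorm_le_norm norm_bounded]) auto

lemma sup_norm_leI:
  fixes f :: "'t::topological_space \<Rightarrow>\<^sub>C (real ^ 'd)"
  shows "(\<And>t. infnorm (apply_bcontfun f t) \<le> b) \<Longrightarrow> sup_norm f \<le> b"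
  unfolding sup_norm_def by (intro cSUP_least) auto

lemma sup_norm_nonneg: "0 \<le> sup_norm f"
  using infnorm_le_sup_norm[of f undefined] infnorm_pos_le order_trans by blast

lemma sup_norm_diff_le: "sup_norm (f - g) \<le> sup_norm f + sup_norm g"
proof (rule sup_norm_leI)
  fix t
  have "infnorm (apply_bcontfun f t + - apply_bcontfun g t) \<le> infnorm (apply_bcontfun f t) + infnorm (apply_bcontfun g t)"
    by (metis infnorm_triangle infnorm_neg)
  also have "\<dots> \<le> sup_norm f + sup_norm g"
    by (intro add_mono infnorm_le_sup_norm)
  finally show "infnorm (apply_bcontfun (f - g) t) \<le> sup_norm f + sup_norm g"
    by (simp add: minus_bcontfun.rep_eq)
qed

lemma norm_component_le_sup_norm: "norm (component i f) \<le> sup_norm f"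
proof (rule norm_bound)
  fix t
  show "norm (apply_bcontfun (component i f) t) \<le> sup_norm f"
    using component_le_infnorm_cart[of "apply_bcontfun f t" i] infnorm_le_sup_norm[of f t]
    by (simp add: apply_component)
qed

lemma component_diff: "component i (f - g) = component i f - component i g"
  by (rule bcontfun_eqI) (simp add: apply_component minus_bcontfun.rep_eq)

lemma component_of_components: "component i (of_components F) = F i"
  by (rule bcontfun_eqI) (simp add: apply_component apply_of_components)

text \<open>The comparison of norms is applied at each \<open>t\<close>, where \<open>\<bar>f t $ i\<bar>\<close> is at most the supremum norm of the
\<open>i\<close>-th component. The resulting bound does not depend on \<open>t\<close>, so it passes to the supremum.\<close>

lemma sup_norm_powr_le_sum:
  fixes f :: "'t::topological_space \<Rightarrow>\<^sub>C (real ^ 'd)"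
  assumes "0 < r" "0 < c" "\<And>x :: real ^ 'd. infnorm x \<le> c * lr_norm r x"
  shows "sup_norm f powr r \<le> c powr r * (\<Sum>i\<in>UNIV. norm (component i f) powr r)"
proof -
  have "sup_norm f \<le> c * (\<Sum>i\<in>UNIV. norm (component i f) powr r) powr (1 / r)"
  proof (rule sup_norm_leI)
    fix t
    have "(\<Sum>i\<in>UNIV. \<bar>apply_bcontfun f t $ i\<bar> powr r) \<le> (\<Sum>i\<in>UNIV. norm (component i f) powr r)"
      using assms(1) norm_bounded[of "component _ f" t]
      by (intro sum_mono powr_mono2) (auto simp: apply_component)
    then have "c * lr_norm r (apply_bcontfun f t) \<le> c * (\<Sum>i\<in>UNIV. norm (component i f) powr r) powr (1 / r)"
      unfolding lr_norm_def using assms(1,2)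
      by (intro mult_left_mono powr_mono2) (auto intro: sum_nonneg)
    with assms(3) show "infnorm (apply_bcontfun f t) \<le> c * (\<Sum>i\<in>UNIV. norm (component i f) powr r) powr (1 / r)"
      by (rule order_trans)
  qed
  then have "sup_norm f powr r \<le> (c * (\<Sum>i\<in>UNIV. norm (component i f) powr r) powr (1 / r)) powr r"
    using assms(1) by (intro powr_mono2) (auto simp: sup_norm_nonneg)
  also have "\<dots> = c powr r * (\<Sum>i\<in>UNIV. norm (component i f) powr r)"
    using assms(1,2) by (simp add: powr_mult powr_powr sum_nonneg)
  finally show ?thesis .
qed

section \<open>Codebooks for the vector process and for its components\<close>

lemma component_codebook:
  assumes "\<alpha> \<in> codebooks m"
  shows "component i ` \<alpha> \<in> codebooks m"
  using codebooksD[OF assms] card_image_le[of \<alpha> "component i"]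
  by (intro codebooksI) auto

lemma product_codebook:
  fixes \<alpha> :: "'d::finite \<Rightarrow> ('t::topological_space \<Rightarrow>\<^sub>C real) set"
  assumes "\<And>i. \<alpha> i \<in> codebooks (k i)" "(\<Prod>i\<in>UNIV. k i) \<le> n"
  shows "of_components ` (PiE UNIV \<alpha>) \<in> codebooks n"
proof (rule codebooksI)
  note \<alpha> = codebooksD[OF assms(1)]
  show fin: "finite (of_components ` (PiE UNIV \<alpha>))"
    using \<alpha> by (intro finite_imageI finite_PiE) auto
  show "of_components ` (PiE UNIV \<alpha>) \<noteq> {}"
    using \<alpha> by (simp add: PiE_eq_empty_iff)
  have "card (of_components ` (PiE UNIV \<alpha>)) \<le> card (PiE UNIV \<alpha>)"
    using \<alpha> by (intro card_image_le finite_PiE) auto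
  also have "\<dots> = (\<Prod>i\<in>UNIV. card (\<alpha> i))"
    by (rule card_PiE) simp
  also have "\<dots> \<le> (\<Prod>i\<in>UNIV. k i)"
    using \<alpha> by (intro prod_mono) auto
  finally show "card (of_components ` (PiE UNIV \<alpha>)) \<le> n"
    using assms(2) by simp
qed

lemma MIN_component_le:
  assumes "0 < r" "\<alpha> \<in> codebooks m"
  shows "(MIN b\<in>component i ` \<alpha>. norm (component i f - b) powr r) \<le> (MIN a\<in>\<alpha>. sup_norm (f - a) powr r)"
proof -
  note \<alpha> = codebooksD[OF assms(2)]
  have "(MIN b\<in>component i ` \<alpha>. norm (component i f - b) powr r) \<le> sup_norm (f - a) powr r" if "a \<in> \<alpha>" for a
  proof (rule Min.coboundedI[THEN order_trans])
    show "norm (component i f - component i a) powr r \<le> sup_norm (f - a) powr r"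
      using assms(1) norm_component_le_sup_norm[of i "f - a"]
      by (intro powr_mono2) (auto simp: component_diff)
  qed (use \<alpha> that in auto)
  then show ?thesis
    using \<alpha> by simp
qed

text \<open>Every choice of one code point per component is a member of the product codebook, in particular the
choice of the nearest ones. Hence the minimum over the product is at most the sum of separate minima.\<close>

lemma MIN_product_le:
  fixes f :: "'t::topological_space \<Rightarrow>\<^sub>C (real ^ 'd)"
  assumes "0 < r" "0 < c" "\<And>x :: real ^ 'd. infnorm x \<le> c * lr_norm r x"
    and "\<And>i. \<alpha> i \<in> codebooks (k i)"
  shows "(MIN a\<in>of_components ` (PiE UNIV \<alpha>). sup_norm (f - a) powr r)
    \<le> c powr r * (\<Sum>i\<in>UNIV. MIN b\<in>\<alpha> i. norm (component i f - b) powr r)"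
proof -
  note \<alpha> = codebooksD[OF assms(4)]
  have "\<exists>b\<in>\<alpha> i. (MIN b\<in>\<alpha> i. norm (component i f - b) powr r) = norm (component i f - b) powr r" for i
    using Min_in[of "(\<lambda>b. norm (component i f - b) powr r) ` \<alpha> i"] \<alpha>[of i] by (simp add: image_iff)
  then obtain F where F: "\<And>i. F i \<in> \<alpha> i"
    "\<And>i. (MIN b\<in>\<alpha> i. norm (component i f - b) powr r) = norm (component i f - F i) powr r"
    by metis
  have "(MIN a\<in>of_components ` (PiE UNIV \<alpha>). sup_norm (f - a) powr r) \<le> sup_norm (f - of_components F) powr r"
    using \<alpha> F(1) by (intro Min_le finite_imageI finite_PiE imageI) auto
  also have "\<dots> \<le> c powr r * (\<Sum>i\<in>UNIV. norm (component i (f - of_components F)) powr r)"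
    using assms(1-3) by (rule sup_norm_powr_le_sum)
  finally show ?thesis
    by (simp add: F(2) component_diff component_of_components)
qed

section \<open>Integrability of the distances to code points\<close>

lemma borel_measurable_sup_norm_diff:
  fixes X :: "'t::metric_space \<Rightarrow> 'w \<Rightarrow> real ^ 'd"
  assumes "compact (UNIV :: 't set)" "\<And>t. X t \<in> borel_measurable M"
    and "\<And>\<omega>. \<omega> \<in> space M \<Longrightarrow> continuous_on UNIV (\<lambda>t. X t \<omega>)"
  shows "(\<lambda>\<omega>. sup_norm (path_of X \<omega> - a)) \<in> borel_measurable M"
proof -
  have "(\<lambda>\<omega>. SUP t. infnorm (X t \<omega> - apply_bcontfun a t)) \<in> borel_measurable M"
  proof (rule borel_measurable_SUP_continuous)
    fix t
    have "infnorm \<in> borel_measurable (borel :: (real ^ 'd) measure)"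
      by (intro borel_measurable_continuous_onI continuous_on_infnorm continuous_on_id)
    then show "(\<lambda>\<omega>. infnorm (X t \<omega> - apply_bcontfun a t)) \<in> borel_measurable M"
      using assms(2)[of t] by measurable
  qed (use assms in \<open>auto intro!: continuous_on_infnorm continuous_intros\<close>)
  then show ?thesis
    by (rule measurable_cong[THEN iffD2, rotated])
      (use assms in \<open>simp add: sup_norm_def minus_bcontfun.rep_eq apply_path_of\<close>)
qed

lemma borel_measurable_norm_diff:
  fixes Z :: "'t::metric_space \<Rightarrow> 'w \<Rightarrow> real"
  assumes "compact (UNIV :: 't set)" "\<And>t. Z t \<in> borel_measurable M"
    and "\<And>\<omega>. \<omega> \<in> space M \<Longrightarrow> continuous_on UNIV (\<lambda>t. Z t \<omega>)"
  shows "(\<lambda>\<omega>. norm (path_of Z \<omega> - b)) \<in> borel_measurable M"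
proof -
  have "(\<lambda>\<omega>. SUP t. dist (Z t \<omega>) (apply_bcontfun b t)) \<in> borel_measurable M"
    using assms by (intro borel_measurable_SUP_continuous borel_measurable_dist) (auto intro!: continuous_intros)
  then show ?thesis
    by (rule measurable_cong[THEN iffD2, rotated])
      (use assms in \<open>simp add: dist_norm[symmetric] dist_bcontfun_def apply_path_of\<close>)
qed

lemma path_of_component:
  fixes X :: "'t::metric_space \<Rightarrow> 'w \<Rightarrow> real ^ 'd"
  assumes "compact (UNIV :: 't set)" "continuous_on UNIV (\<lambda>t. X t \<omega>)"
  shows "path_of (\<lambda>t \<omega>. X t \<omega> $ i) \<omega> = component i (path_of X \<omega>)"
  using assms
  by (intro bcontfun_eqI) (simp add: apply_component apply_path_of continuous_on_component)

theorem proposition5: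
  fixes M :: "'w measure"
    and X :: "'t::metric_space \<Rightarrow> 'w \<Rightarrow> real ^ 'd"
    and r c :: real
    and n :: nat
    and k :: "'d \<Rightarrow> nat"
  assumes "prob_space M"
    and "compact (UNIV :: 't set)"
    and "0 < r"
    and "\<And>t. X t \<in> borel_measurable M"
    and "\<And>\<omega>. \<omega> \<in> space M \<Longrightarrow> continuous_on UNIV (\<lambda>t. X t \<omega>)"
    and "(\<integral>\<^sup>+\<omega>. ennreal (sup_norm (path_of X \<omega>) powr r) \<partial>M) < \<infinity>"
    and "0 < c"
    and "\<And>x :: real ^ 'd. infnorm x \<le> c * lr_norm r x"
    and "1 \<le> n"
    and "\<And>i. 1 \<le> k i"
    and "(\<Prod>i\<in>UNIV. k i) \<le> n"
  shows "(MAX i. quant_error M norm r n (path_of (\<lambda>t \<omega>. X t \<omega> $ i)) powr r)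
           \<le> quant_error M sup_norm r n (path_of X) powr r
       \<and> quant_error M sup_norm r n (path_of X) powr r
           \<le> c powr r * (\<Sum>i\<in>UNIV. quant_error M norm r (k i) (path_of (\<lambda>t \<omega>. X t \<omega> $ i)) powr r)"
proof
  note T = assms(2) and r = assms(3) and meas = assms(4) and cont = assms(5)
  interpret prob_space M by fact
  let ?X = "path_of X" and ?Z = "\<lambda>i. path_of (\<lambda>t \<omega>. X t \<omega> $ i)"
  have Z: "?Z i \<omega> = component i (?X \<omega>)" if "\<omega> \<in> space M" for i \<omega>
    using path_of_component[of X \<omega> i] T cont[OF that] by simp
  have meas_Z: "(\<lambda>\<omega>. X t \<omega> $ i) \<in> borel_measurable M" for t i
    using meas[of t] by (rule measurable_compose[OF _ borel_measurable_nth])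
  have moment: "integrable M (\<lambda>\<omega>. sup_norm (?X \<omega>) powr r)"
  proof (rule integrableI_nonneg)
    show "(\<lambda>\<omega>. sup_norm (?X \<omega>) powr r) \<in> borel_measurable M"
      using borel_measurable_sup_norm_diff[OF T meas cont, where a = 0] by simp
  qed (use assms(6) in auto)
  have int_X: "integrable M (\<lambda>\<omega>. sup_norm (?X \<omega> - a) powr r)" for a
    using borel_measurable_sup_norm_diff[OF T meas cont]
    by (intro integrable_powr_le_add_const[OF finite_measure_axioms r _ moment, where K = "sup_norm a"])
      (auto simp: sup_norm_nonneg sup_norm_diff_le)
  have int_Z: "integrable M (\<lambda>\<omega>. norm (?Z i \<omega> - b) powr r)" for i b
  proof (rule integrable_powr_le_add_const[OF finite_measure_axioms r _ moment, where K = "norm b"])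
    show "(\<lambda>\<omega>. norm (?Z i \<omega> - b)) \<in> borel_measurable M"
      using T meas_Z cont by (intro borel_measurable_norm_diff) (auto intro: continuous_on_component)
    show "norm (?Z i \<omega> - b) \<le> sup_norm (?X \<omega>) + norm b" if "\<omega> \<in> space M" for \<omega>
      using norm_triangle_ineq4[of "?Z i \<omega>" b] norm_component_le_sup_norm[of i "?X \<omega>"] Z[OF that, of i]
      by simp
  qed (auto simp: sup_norm_nonneg)
  show "(MAX i. quant_error M norm r n (?Z i) powr r) \<le> quant_error M sup_norm r n ?X powr r"
  proof -
    have "quant_error M norm r n (?Z i) powr r \<le> quant_error M sup_norm r n ?X powr r" for i
    proof (rule le_quant_error_powr[OF r assms(9)])
      fix \<alpha> :: "('t \<Rightarrow>\<^sub>C (real ^ 'd)) set"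
      assume \<alpha>: "\<alpha> \<in> codebooks n"
      have "quant_error M norm r n (?Z i) powr r \<le> distortion M norm r (component i ` \<alpha>) (?Z i)"
        using r component_codebook[OF \<alpha>] by (rule quant_error_powr_le_distortion)
      also have "\<dots> \<le> distortion M sup_norm r \<alpha> ?X"
        unfolding distortion_def
      proof (rule integral_mono)
        show "integrable M (\<lambda>\<omega>. MIN b\<in>component i ` \<alpha>. norm (?Z i \<omega> - b) powr r)"
          using codebooksD[OF component_codebook[OF \<alpha>]] int_Z by (intro integrable_MIN) auto
        show "integrable M (\<lambda>\<omega>. MIN a\<in>\<alpha>. sup_norm (?X \<omega> - a) powr r)"
          using codebooksD[OF \<alpha>] int_X by (intro integrable_MIN) auto
      qed (use MIN_component_le[OF r \<alpha>] Z in simp)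
      finally show "quant_error M norm r n (?Z i) powr r \<le> distortion M sup_norm r \<alpha> ?X" .
    qed simp
    then show ?thesis
      by simp
  qed
  show "quant_error M sup_norm r n ?X powr r \<le> c powr r * (\<Sum>i\<in>UNIV. quant_error M norm r (k i) (?Z i) powr r)"
  proof (rule field_le_epsilon)
    fix e :: real assume "0 < e"
    \<comment> \<open>chosen so that the excesses of the \<open>CARD('d)\<close> components, once multiplied by \<open>c powr r\<close>, add up to \<open>e\<close>\<close>
    define \<epsilon> where "\<epsilon> = e / (c powr r * real CARD('d))"
    have "0 < \<epsilon>"
      using \<open>0 < e\<close> assms(7) by (simp add: \<epsilon>_def)
    then have "\<exists>\<alpha>. \<alpha> \<in> codebooks (k i) \<and>
        distortion M norm r \<alpha> (?Z i) < quant_error M norm r (k i) (?Z i) powr r + \<epsilon>" for i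
      using near_optimal_codebook[OF r assms(10)] by metis
    then obtain \<alpha> where \<alpha>: "\<And>i. \<alpha> i \<in> codebooks (k i)"
      "\<And>i. distortion M norm r (\<alpha> i) (?Z i) < quant_error M norm r (k i) (?Z i) powr r + \<epsilon>"
      by metis
    let ?\<beta> = "of_components ` (PiE UNIV \<alpha>)"
    have \<beta>: "?\<beta> \<in> codebooks n"
      using \<alpha>(1) assms(11) by (rule product_codebook)
    have int_MIN: "integrable M (\<lambda>\<omega>. MIN b\<in>\<alpha> i. norm (?Z i \<omega> - b) powr r)" for i
      using codebooksD[OF \<alpha>(1)] int_Z by (intro integrable_MIN) auto
    have "quant_error M sup_norm r n ?X powr r \<le> distortion M sup_norm r ?\<beta> ?X"
      using r \<beta> by (rule quant_error_powr_le_distortion)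
    also have "\<dots> \<le> (\<integral>\<omega>. c powr r * (\<Sum>i\<in>UNIV. MIN b\<in>\<alpha> i. norm (?Z i \<omega> - b) powr r) \<partial>M)"
      unfolding distortion_def
    proof (rule integral_mono)
      show "integrable M (\<lambda>\<omega>. MIN a\<in>?\<beta>. sup_norm (?X \<omega> - a) powr r)"
        using codebooksD[OF \<beta>] int_X by (intro integrable_MIN) auto
      show "integrable M (\<lambda>\<omega>. c powr r * (\<Sum>i\<in>UNIV. MIN b\<in>\<alpha> i. norm (?Z i \<omega> - b) powr r))"
        using int_MIN by simp
    qed (use MIN_product_le[OF r assms(7,8) \<alpha>(1)] Z in simp)
    also have "\<dots> = c powr r * (\<Sum>i\<in>UNIV. distortion M norm r (\<alpha> i) (?Z i))"
      using int_MIN by (simp add: distortion_def)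
    also have "\<dots> \<le> c powr r * (\<Sum>i\<in>UNIV. quant_error M norm r (k i) (?Z i) powr r + \<epsilon>)"
      using \<alpha>(2) by (intro mult_left_mono sum_mono) (auto intro: less_imp_le)
    also have "\<dots> = c powr r * (\<Sum>i\<in>UNIV. quant_error M norm r (k i) (?Z i) powr r) + e"
    proof -
      have "c powr r * (real CARD('d) * \<epsilon>) = e"
        using assms(7) by (simp add: \<epsilon>_def)
      then show ?thesis
        by (simp add: sum.distrib distrib_left)
    qed
    finally show "quant_error M sup_norm r n ?X powr r
      \<le> c powr r * (\<Sum>i\<in>UNIV. quant_error M norm r (k i) (?Z i) powr r) + e" .
  qed
qed

end
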